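(* Let $T:A^{\mathbb Z}\to A^{\mathbb Z}$ be the cellular automaton defined in the context. Then $(A^{\mathbb Z},T)$ is almost diam-mean equicontinuous but not almost equicontinuous.
   Context: $\mathbb N$ includes $0$. For a finite alphabet $A$, the full shift $A^{\mathbb Z}$ carries the metric $d(x,y)=2^{-i}$ with $i=\min\{|j|:x_j\ne y_j\}$ if $x\neq y$, and $d(x,x)=0$. $B_\delta(x)=\{y: d(x,y)<\delta\}$ and $\operatorname{diam}$ denotes diameter. A cellular automaton is a continuous map $A^{\mathbb Z}\to A^{\mathbb Z}$ commuting with the shift $\sigma(x)_i=x_{i+1}$. For a compact metric space $X$ and continuous $T:X\to X$: $x\in X$ is an equicontinuity point if for every $\varepsilon>0$ there is $\delta>0$ with $\operatorname{diam}(T^iB_\delta(x))<\varepsilon$ for all $i\in\mathbb N$; $x$ is a diam-mean equicontinuity point if for every $\varepsilon>0$ there is $\delta>0$ with $\limsup_{n\to\infty}\frac1{n+1}\sum_{i=0}^n\operatorname{diam}(T^iB_\delta(x))<\varepsilon$. $(X,T)$ is almost equicontinuous (resp. almost diam-mean equicontinuous) if the set of equicontinuity points (resp. diam-mean equicontinuity points) is residual, i.e. contains a countable intersection of dense open sets. The automaton $T$. Let $A_1=\{\square,0,1,2\}$, where $\square$ is a blank symbol, and define $T_1:A_1^{\mathbb Z}\to A_1^{\mathbb Z}$ by: $(T_1x)_i=\square$ if $x_i=\square$; if $x_i\ne\square$, then $(T_1x)_i=x_i+1 \bmod 3$ if $x_{i+1}\in\{\square,2\}$ and $(T_1x)_i=x_i$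 otherwise. Let $A_2=\{\square,\leftarrow\}$, $A=A_1\times A_2$, and let $\gamma_1:A^{\mathbb Z}\to A_1^{\mathbb Z}$, $\gamma_2:A^{\mathbb Z}\to A_2^{\mathbb Z}$ be the coordinatewise projections. $T:A^{\mathbb Z}\to A^{\mathbb Z}$ is given by $\gamma_1(Tx)=T_1(\gamma_1(x))$ and: $\gamma_2(Tx)_i=\leftarrow$ if and only if either [$\gamma_2(x)_{i+1}=\leftarrow$ and $\gamma_1(x)_{i+1}\in\{\square,2\}$] or [$\gamma_2(x)_i=\leftarrow$ and $\gamma_1(x)_i\in\{0,1\}$]; otherwise $\gamma_2(Tx)_i=\square$. (An arrow moves one step left exactly when the first coordinate at its position is $\square$ or $2$, otherwise it stays; overlapping arrows merge.) *)

theory Defs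
  imports "HOL-Analysis.Analysis"
begin

section \<open>The full shift as a metric space\<close>

typedef 'a config = "UNIV :: (int \<Rightarrow> 'a) set"
  morphisms cell Config
  by simp

lemma cell_Config [simp]: "cell (Config f) = f"
  by (simp add: Config_inverse)

lemma config_eqI: "(\<And>i. cell x i = cell y i) \<Longrightarrow> x = y"
  by (metis cell_inject ext)

definition first_diff :: "'a config \<Rightarrow> 'a config \<Rightarrow> nat" where
  "first_diff x y = (LEAST n. \<exists>j. nat \<bar>j\<bar> = n \<and> cell x j \<noteq> cell y j)"

definition config_dist :: "'a config \<Rightarrow> 'a config \<Rightarrow> real" where
  "config_dist x y = (if x = y then 0 else (1/2) ^ first_diff x y)"

lemma config_dist_less_iff:
  "config_dist x y < (1/2) ^ n \<longleftrightarrow> (\<forall>j. \<bar>j\<bar> \<le> int n \<longrightarrow> cell x j = cell y j)"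
proof (cases "x = y")
  case True
  then show ?thesis by (simp add: config_dist_def)
next
  case False
  let ?P = "\<lambda>n. \<exists>j. nat \<bar>j\<bar> = n \<and> cell x j \<noteq> cell y j"
  obtain k where "cell x k \<noteq> cell y k"
    using False config_eqI by blast
  then have "?P (nat \<bar>k\<bar>)" by blast
  then have ex: "?P (first_diff x y)"
    unfolding first_diff_def by (rule LeastI)
  have le: "first_diff x y \<le> nat \<bar>j\<bar>" if "cell x j \<noteq> cell y j" for j
    unfolding first_diff_def by (rule Least_le) (use that in blast)
  have "config_dist x y < (1/2) ^ n \<longleftrightarrow> n < first_diff x y"
    using False by (simp add: config_dist_def power_strict_decreasing_iff)
  also have "\<dots> \<longleftrightarrow> (\<forall>j. \<bar>j\<bar> \<le> int n \<longrightarrow> cell x j = cell y j)"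
  proof
    assume "n < first_diff x y"
    then show "\<forall>j. \<bar>j\<bar> \<le> int n \<longrightarrow> cell x j = cell y j"
      using le by fastforce
  next
    assume *: "\<forall>j. \<bar>j\<bar> \<le> int n \<longrightarrow> cell x j = cell y j"
    from ex obtain j where "nat \<bar>j\<bar> = first_diff x y" "cell x j \<noteq> cell y j" by blast
    with * show "n < first_diff x y"
      by (metis linorder_not_less nat_le_iff)
  qed
  finally show ?thesis .
qed

lemma config_dist_sym: "config_dist x y = config_dist y x"
proof -
  have "first_diff x y = first_diff y x"
    unfolding first_diff_def by (rule arg_cong[where f = Least]) fastforce
  then show ?thesis by (auto simp: config_dist_def)
qed

lemma config_dist_ultra: "config_dist x z \<le> max (config_dist x y) (config_dist y z)"
proof (rule ccontr)
  assume "\<not> ?thesis"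
  then have *: "config_dist x y < config_dist x z" "config_dist y z < config_dist x z"
    by auto
  then have "x \<noteq> z"
    by (auto simp: config_dist_def split: if_splits)
  then have eq: "config_dist x z = (1/2) ^ first_diff x z"
    by (simp add: config_dist_def)
  have "\<forall>j. \<bar>j\<bar> \<le> int (first_diff x z) \<longrightarrow> cell x j = cell z j"
    using * unfolding eq config_dist_less_iff by simp
  then have "config_dist x z < (1/2) ^ first_diff x z"
    unfolding config_dist_less_iff .
  with eq show False by simp
qed

instantiation config :: (type) metric_space
begin

definition dist_config_def: "dist = (config_dist :: 'a config \<Rightarrow> 'a config \<Rightarrow> real)"

definition uniformity_config_def:
  "(uniformity :: ('a config \<times> 'a config) filter) =
     (INF e\<in>{0 <..}. principal {(x, y). dist x y < e})"

definition open_config_def: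
  "open (U :: 'a config set) \<longleftrightarrow>
     (\<forall>x\<in>U. eventually (\<lambda>(x', y). x' = x \<longrightarrow> y \<in> U) uniformity)"

instance
proof
  fix x y z :: "'a config"
  show "dist x y = 0 \<longleftrightarrow> x = y"
    by (simp add: dist_config_def config_dist_def)
  have "0 \<le> config_dist x z" "0 \<le> config_dist y z" for x y z :: "'a config"
    by (simp_all add: config_dist_def)
  then show "dist x y \<le> dist x z + dist y z"
    using config_dist_ultra[of x y z] config_dist_sym[of y z]
    by (smt (verit) dist_config_def)
qed (rule uniformity_config_def open_config_def)+

end

section \<open>Cellular automata\<close>

definition shift :: "'a config \<Rightarrow> 'a config" where
  "shift x = Config (\<lambda>i. cell x (i + 1))"

definition cellular_automaton :: "('a::finite config \<Rightarrow> 'a config) \<Rightarrow> bool" where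
  "cellular_automaton T \<longleftrightarrow> continuous_on UNIV T \<and> T \<circ> shift = shift \<circ> T"

section \<open>Equicontinuity notions\<close>

text \<open>The space is the whole type. The notions are intended for compact spaces and continuous
  maps; on an unbounded space \<^const>\<open>diameter\<close> would not be meaningful.\<close>

definition equicontinuity_point :: "('a::metric_space \<Rightarrow> 'a) \<Rightarrow> 'a \<Rightarrow> bool" where
  "equicontinuity_point T x \<longleftrightarrow>
     (\<forall>\<epsilon>>0. \<exists>\<delta>>0. \<forall>i. diameter ((T ^^ i) ` ball x \<delta>) < \<epsilon>)"

definition diam_mean_equicontinuity_point :: "('a::metric_space \<Rightarrow> 'a) \<Rightarrow> 'a \<Rightarrow> bool" where
  "diam_mean_equicontinuity_point T x \<longleftrightarrow>
     (\<forall>\<epsilon>>0. \<exists>\<delta>>0.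
        limsup (\<lambda>n. ereal (1 / real (n + 1) * (\<Sum>i=0..n. diameter ((T ^^ i) ` ball x \<delta>))))
          < ereal \<epsilon>)"

definition residual :: "'a::topological_space set \<Rightarrow> bool" where
  "residual S \<longleftrightarrow>
     (\<exists>\<G>. countable \<G> \<and> (\<forall>G\<in>\<G>. open G \<and> closure G = UNIV) \<and> \<Inter>\<G> \<subseteq> S)"

definition almost_equicontinuous :: "('a::metric_space \<Rightarrow> 'a) \<Rightarrow> bool" where
  "almost_equicontinuous T \<longleftrightarrow> residual {x. equicontinuity_point T x}"

definition almost_diam_mean_equicontinuous :: "('a::metric_space \<Rightarrow> 'a) \<Rightarrow> bool" where
  "almost_diam_mean_equicontinuous T \<longleftrightarrow> residual {x. diam_mean_equicontinuity_point T x}"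

section \<open>The automaton\<close>

datatype sym1 = Blank | D0 | D1 | D2

datatype sym2 = NoArrow | Arrow

instance sym1 :: finite
proof
  have "(UNIV :: sym1 set) = {Blank, D0, D1, D2}"
    by (auto intro: sym1.exhaust)
  then show "finite (UNIV :: sym1 set)"
    by (metis finite.emptyI finite.insertI)
qed

instance sym2 :: finite
proof
  have "(UNIV :: sym2 set) = {NoArrow, Arrow}"
    by (auto intro: sym2.exhaust)
  then show "finite (UNIV :: sym2 set)"
    by (metis finite.emptyI finite.insertI)
qed

text \<open>Addition of 1 modulo 3; the value at \<^const>\<open>Blank\<close> is never used.\<close>

fun incr :: "sym1 \<Rightarrow> sym1" where
  "incr Blank = Blank"
| "incr D0 = D1"
| "incr D1 = D2"
| "incr D2 = D0"

definition T1 :: "sym1 config \<Rightarrow> sym1 config" where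
  "T1 x = Config (\<lambda>i.
     if cell x i = Blank then Blank
     else if cell x (i + 1) \<in> {Blank, D2} then incr (cell x i)
     else cell x i)"

definition proj1 :: "(sym1 \<times> sym2) config \<Rightarrow> sym1 config" where
  "proj1 x = Config (\<lambda>i. fst (cell x i))"

definition proj2 :: "(sym1 \<times> sym2) config \<Rightarrow> sym2 config" where
  "proj2 x = Config (\<lambda>i. snd (cell x i))"

definition T :: "(sym1 \<times> sym2) config \<Rightarrow> (sym1 \<times> sym2) config" where
  "T x = Config (\<lambda>i.
     (cell (T1 (proj1 x)) i,
      if (cell (proj2 x) (i + 1) = Arrow \<and> cell (proj1 x) (i + 1) \<in> {Blank, D2})
         \<or> (cell (proj2 x) i = Arrow \<and> cell (proj1 x) i \<in> {D0, D1})
      then Arrow else NoArrow))"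

lemma cellular_automaton_T: "cellular_automaton T"
proof -
  have "continuous_on UNIV T"
    unfolding continuous_on_iff
  proof (intro ballI allI impI)
    fix x :: "(sym1 \<times> sym2) config" and e :: real
    assume "0 < e"
    then obtain n where n: "(1/2) ^ n < e"
      using real_arch_pow_inv[of e "1/2"] by auto
    have "dist (T y) (T x) < e" if "dist y x < (1/2) ^ Suc n" for y
    proof -
      have eq: "cell y j = cell x j" if "\<bar>j\<bar> \<le> int (Suc n)" for j
        using \<open>dist y x < _\<close> that unfolding dist_config_def config_dist_less_iff by blast
      have "cell (T y) j = cell (T x) j" if "\<bar>j\<bar> \<le> int n" for j
      proof -
        have "cell y j = cell x j" "cell y (j + 1) = cell x (j + 1)"
          using that by (auto intro!: eq)
        then show ?thesis
          by (simp add: T_def T1_def proj1_def proj2_def)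
      qed
      then have "dist (T y) (T x) < (1/2) ^ n"
        unfolding dist_config_def config_dist_less_iff by blast
      with n show ?thesis by simp
    qed
    then show "\<exists>d>0. \<forall>y\<in>UNIV. dist y x < d \<longrightarrow> dist (T y) (T x) < e"
      by (intro exI[of _ "(1/2) ^ Suc n"]) auto
  qed
  moreover have "T \<circ> shift = shift \<circ> T"
  proof
    fix x
    show "(T \<circ> shift) x = (shift \<circ> T) x"
      by (rule config_eqI) (simp add: shift_def T_def T1_def proj1_def proj2_def)
  qed
  ultimately show ?thesis
    by (simp add: cellular_automaton_def)
qed

end

theory Submission
  imports Defs
begin

text \<open>Information only travels to the left, and a blank makes the digits on its left independent
  of everything on its right. Every digit to the left of a blank is \<open>2\<close> at least once in any time
  window of a length depending only on its distance to the blank, so arrows never get stuck there.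

  For mean equicontinuity, place \<open>2^j - 1\<close> zeros and a blank to the right of a window and a first
  blank. The digits of this word form a counter whose leftmost digit is \<open>2\<close> only at times
  \<open>t\<close> with \<open>3^j\<close> dividing \<open>t + 1\<close>, so arrows from outside enter the window at most once
  every \<open>3^j\<close> steps, and each of them leaves it within a time independent of \<open>j\<close>.

  No point is an equicontinuity point: put blanks to the right of a large window, once with arrows
  everywhere and once without. In the first case arrows visit the origin infinitely often, in
  the second case only finitely often. Baire's theorem then rules out residuality.\<close>

section \<open>Configurations\<close>

lemma dist_config_less_iff:
  "dist x y < (1/2) ^ n \<longleftrightarrow> (\<forall>j. \<bar>j\<bar> \<le> int n \<longrightarrow> cell x j = cell y j)"
  by (simp add: dist_config_def config_dist_less_iff)

lemma dist_config_less_1_iff: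
  fixes x y :: "'a config"
  shows "dist x y < 1 \<longleftrightarrow> cell x 0 = cell y 0"
  using dist_config_less_iff[of x y 0] by simp

lemma dist_config_le_1: "dist (x :: 'a config) y \<le> 1"
  by (simp add: dist_config_def config_dist_def power_le_one)

lemma bounded_config: "bounded (S :: 'a config set)"
  unfolding bounded_def using dist_config_le_1 by blast

text \<open>By the ultrametric inequality every point of a ball is its centre, so one
  \<open>\<delta>\<close> serves all points of the ball. This gives openness in the residuality
  criterion.\<close>

lemma ball_config_eq:
  fixes x y :: "'a config"
  assumes "y \<in> ball x \<delta>"
  shows "ball y \<delta> = ball x \<delta>"
proof -
  have ultra: "dist a c \<le> max (dist a b) (dist b c)" for a b c :: "'a config"
    by (simp add: dist_config_def config_dist_ultra)
  have xy: "dist x y < \<delta>" using assms by simp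
  have "dist x z < \<delta> \<longleftrightarrow> dist y z < \<delta>" for z
    using ultra[of x z y] ultra[of y z x] xy by (auto simp: dist_commute)
  then show ?thesis by auto
qed

section \<open>Completeness and residual sets\<close>

lemma complete_config: "complete (UNIV :: 'a config set)"
  unfolding complete_def
proof (intro allI impI, elim conjE)
  fix f :: "nat \<Rightarrow> 'a config"
  assume "Cauchy f"
  have "\<exists>N. \<forall>m\<ge>N. \<forall>n\<ge>N. dist (f m) (f n) < (1/2) ^ k" for k
    using \<open>Cauchy f\<close> unfolding Cauchy_def by simp
  then obtain N where N: "\<And>k m n. m \<ge> N k \<Longrightarrow> n \<ge> N k \<Longrightarrow> dist (f m) (f n) < (1/2) ^ k"
    by metis
  \<comment> \<open>Cell \<open>i\<close> is read off at an index from which the sequence no longer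
    changes within radius \<open>\<bar>i\<bar>\<close>.\<close>
  define l where "l = Config (\<lambda>i. cell (f (N (nat \<bar>i\<bar>))) i)"
  have "dist (f n) l < (1/2) ^ k" if "n \<ge> N k" for n k
    unfolding dist_config_less_iff
  proof (intro allI impI)
    fix j :: int
    assume j: "\<bar>j\<bar> \<le> int k"
    define p where "p = max n (N (nat \<bar>j\<bar>))"
    have "cell (f n) j = cell (f p) j"
      using N[OF that, of p] that j unfolding dist_config_less_iff p_def by auto
    also have "\<dots> = cell (f (N (nat \<bar>j\<bar>))) j"
      using N[of "nat \<bar>j\<bar>" p "N (nat \<bar>j\<bar>)"] unfolding dist_config_less_iff p_def by auto
    finally show "cell (f n) j = cell l j" by (simp add: l_def)
  qed
  moreover have "\<exists>k. (1/2) ^ k < e" if "e > 0" for e :: real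
    using real_arch_pow_inv[OF that, of "1/2"] by simp
  ultimately have "f \<longlonglongrightarrow> l"
    unfolding lim_sequentially by (meson order.strict_trans)
  then show "\<exists>l\<in>UNIV. f \<longlonglongrightarrow> l" by blast
qed

lemma residual_config_nonempty:
  fixes S :: "'a config set"
  assumes "residual S"
  shows "S \<noteq> {}"
proof -
  obtain \<G> where \<G>: "countable \<G>" "\<And>G. G \<in> \<G> \<Longrightarrow> open G \<and> closure G = (UNIV :: 'a config set)"
    "\<Inter>\<G> \<subseteq> S"
    using assms unfolding residual_def by blast
  have "Met_TC.mtopology closure_of \<Inter>\<G> = (UNIV :: 'a config set)"
    using \<G> by (intro Met_TC.metric_Baire_category) (auto simp: complete_config)
  then have "\<Inter>\<G> \<noteq> {}"
    by auto
  with \<G> show ?thesis by blast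
qed

lemma diameter_leI:
  fixes S :: "'a::metric_space set"
  assumes "0 \<le> d" and "\<And>x y. x \<in> S \<Longrightarrow> y \<in> S \<Longrightarrow> dist x y \<le> d"
  shows "diameter S \<le> d"
  using assms by (auto simp: diameter_def intro!: cSUP_least)

text \<open>The points at which some \<open>\<delta>\<close> works for a fixed
  \<open>\<epsilon>\<close> form an open set, so only density has to be supplied. The nearby
  \<open>y\<close> may depend on \<open>\<epsilon>\<close>; it need not be a diam-mean
  equicontinuity point itself.\<close>

lemma almost_diam_mean_equicontinuous_configI:
  fixes F :: "'a config \<Rightarrow> 'a config"
  assumes "\<And>x m \<epsilon>. \<epsilon> > 0 \<Longrightarrow> \<exists>y \<delta>. dist x y < (1/2) ^ m \<and> \<delta> > 0 \<and>
    limsup (\<lambda>n. ereal (1 / real (n + 1) * (\<Sum>i=0..n. diameter ((F ^^ i) ` ball y \<delta>)))) < ereal \<epsilon>"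
  shows "almost_diam_mean_equicontinuous F"
proof -
  define L where "L y \<delta> =
    limsup (\<lambda>n. ereal (1 / real (n + 1) * (\<Sum>i=0..n. diameter ((F ^^ i) ` ball y \<delta>))))" for y \<delta>
  define U where "U e = {y. \<exists>\<delta>>0. L y \<delta> < ereal e}" for e
  have "open (U e)" for e
    unfolding open_contains_ball
  proof
    fix y assume "y \<in> U e"
    then obtain \<delta> where \<delta>: "\<delta> > 0" "L y \<delta> < ereal e" by (auto simp: U_def)
    have "z \<in> U e" if "z \<in> ball y \<delta>" for z
      using \<delta> ball_config_eq[OF that] by (auto simp: U_def L_def)
    with \<delta> show "\<exists>d>0. ball y d \<subseteq> U e" by blast
  qed
  moreover have "closure (U e) = UNIV" if e: "e > 0" for e
  proof -
    have "x \<in> closure (U e)" for x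
      unfolding closure_approachable
    proof (intro allI impI)
      fix r :: real assume "r > 0"
      then obtain m where m: "(1/2) ^ m < r"
        using real_arch_pow_inv[of r "1/2"] by auto
      obtain y \<delta> where "dist x y < (1/2) ^ m" "\<delta> > 0" "L y \<delta> < ereal e"
        using assms[OF e, of x m] unfolding L_def by blast
      with m show "\<exists>y\<in>U e. dist y x < r"
        by (intro bexI[of _ y]) (auto simp: U_def dist_commute)
    qed
    then show ?thesis by blast
  qed
  moreover have "\<Inter> (range (\<lambda>n. U (1 / real (Suc n)))) \<subseteq> {x. diam_mean_equicontinuity_point F x}"
  proof (intro subsetI CollectI)
    fix x assume x: "x \<in> \<Inter> (range (\<lambda>n. U (1 / real (Suc n))))"
    show "diam_mean_equicontinuity_point F x"
      unfolding diam_mean_equicontinuity_point_def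
    proof (intro allI impI)
      fix \<epsilon> :: real assume "\<epsilon> > 0"
      then obtain n where n: "1 / real (Suc n) < \<epsilon>"
        using nat_approx_posE by blast
      from x obtain \<delta> where "\<delta> > 0" "L x \<delta> < ereal (1 / real (Suc n))"
        by (auto simp: U_def)
      moreover have "ereal (1 / real (Suc n)) < ereal \<epsilon>" using n by simp
      ultimately show "\<exists>\<delta>>0. limsup (\<lambda>n. ereal (1 / real (n + 1) *
          (\<Sum>i=0..n. diameter ((F ^^ i) ` ball x \<delta>)))) < ereal \<epsilon>"
        unfolding L_def by (meson order.strict_trans)
    qed
  qed
  ultimately show ?thesis
    unfolding almost_diam_mean_equicontinuous_def residual_def
    by (intro exI[of _ "range (\<lambda>n. U (1 / real (Suc n)))"]) auto
qed

section \<open>Averages of a sequence that is small off a periodic set\<close>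

text \<open>Each block of \<open>P\<close> indices has at most \<open>K\<close> bad ones. The factor
  2 absorbs the incomplete last block once \<open>n \<ge> P\<close>.\<close>

lemma limsup_average_le:
  fixes d :: "nat \<Rightarrow> real" and K P :: nat
  assumes "P > 0" "0 \<le> c"
    and le1: "\<And>i. d i \<le> 1" and lec: "\<And>i. K \<le> i mod P \<Longrightarrow> d i \<le> c"
  shows "limsup (\<lambda>n. ereal (1 / real (n + 1) * (\<Sum>i=0..n. d i))) \<le> ereal (c + 2 * K / P)"
proof (rule Limsup_bounded, rule eventually_sequentiallyI)
  fix n assume n: "n \<ge> P"
  define B where "B = {i. i \<le> n \<and> i mod P < K}"
  have "card B \<le> card ({..n div P} \<times> {..<K})"
    by (rule card_inj_on_le[of "\<lambda>i. (i div P, i mod P)"])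
      (auto simp: B_def inj_on_def div_le_mono, metis div_mult_mod_eq)
  also have "\<dots> = (n div P + 1) * K" by simp
  finally have "real (card B) \<le> real (n div P + 1) * real K"
    by (metis of_nat_le_iff of_nat_mult)
  also have "\<dots> \<le> (2 * real (n + 1) / P) * real K"
  proof (rule mult_right_mono)
    have "real (n div P) \<le> real n / P" by (rule of_nat_div_le_of_nat)
    moreover have "1 \<le> real n / P" using n \<open>P > 0\<close> by simp
    ultimately have "real (n div P + 1) \<le> 2 * real n / P" by simp
    also have "\<dots> \<le> 2 * real (n + 1) / P" by (intro divide_right_mono) auto
    finally show "real (n div P + 1) \<le> 2 * real (n + 1) / P" .
  qed simp
  finally have card: "real (card B) \<le> real (n + 1) * (2 * K / P)"
    by (simp add: field_simps)
  have "(\<Sum>i=0..n. d i) \<le> (\<Sum>i=0..n. c + (if i \<in> B then 1 else 0))"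
  proof (rule sum_mono)
    fix i assume "i \<in> {0..n}"
    then show "d i \<le> c + (if i \<in> B then 1 else 0)"
      using le1[of i] lec[of i] \<open>0 \<le> c\<close> by (cases "i mod P < K") (auto simp: B_def)
  qed
  also have "\<dots> = real (n + 1) * c + real (card ({0..n} \<inter> B))"
    by (simp add: sum.distrib sum.If_cases)
  also have "{0..n} \<inter> B = B" by (auto simp: B_def)
  also have "real (n + 1) * c + real (card B) \<le> real (n + 1) * (c + 2 * K / P)"
    using card by (simp only: distrib_left)
  finally show "ereal (1 / real (n + 1) * (\<Sum>i=0..n. d i)) \<le> ereal (c + 2 * K / P)"
    by (simp add: pos_divide_le_eq mult.commute)
qed

section \<open>Dynamics of the automaton\<close>

text \<open>The single condition governing both layers: a passing cell increments the digit on its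
  left and sends its own arrow left.\<close>

definition passes :: "sym1 \<Rightarrow> bool" where
  "passes s \<longleftrightarrow> s \<in> {Blank, D2}"

abbreviation dig :: "(sym1 \<times> sym2) config \<Rightarrow> nat \<Rightarrow> int \<Rightarrow> sym1" where
  "dig x t i \<equiv> fst (cell ((T ^^ t) x) i)"

abbreviation arr :: "(sym1 \<times> sym2) config \<Rightarrow> nat \<Rightarrow> int \<Rightarrow> bool" where
  "arr x t i \<equiv> snd (cell ((T ^^ t) x) i) = Arrow"

lemma dig_Suc: "dig x (Suc t) i = (if passes (dig x t (i + 1)) then incr (dig x t i) else dig x t i)"
  by (simp add: T_def T1_def proj1_def passes_def)

lemma arr_Suc:
  "arr x (Suc t) i \<longleftrightarrow>
     arr x t (i + 1) \<and> passes (dig x t (i + 1)) \<or> arr x t i \<and> \<not> passes (dig x t i)"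
  by (cases "dig x t i") (auto simp: T_def proj1_def proj2_def passes_def)

declare funpow.simps [simp del]

section \<open>Digits to the left of a blank\<close>

lemma dig_Blank_mono:
  assumes "dig x t i = Blank" and "t \<le> s"
  shows "dig x s i = Blank"
  using assms(2,1) by (induction s rule: dec_induct) (auto simp: dig_Suc)

text \<open>A digit looks only at its right neighbour, and the blank at \<open>r\<close> persists in
  both configurations, so nothing beyond \<open>r\<close> is felt.\<close>

lemma dig_eq_left_of_Blank:
  assumes "\<And>i. l \<le> i \<Longrightarrow> i \<le> r \<Longrightarrow> dig x 0 i = dig y 0 i" and "dig x 0 r = Blank"
  shows "l \<le> i \<Longrightarrow> i \<le> r \<Longrightarrow> dig x t i = dig y t i"
proof (induction t arbitrary: i)
  case (Suc t)
  show ?case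
  proof (cases "i = r")
    case True
    then have "dig y 0 i = Blank" using assms Suc.prems by metis
    then show ?thesis
      using dig_Blank_mono[of 0 x i "Suc t"] dig_Blank_mono[of 0 y i "Suc t"] assms(2) True by simp
  next
    case False
    with Suc show ?thesis by (simp add: dig_Suc)
  qed
qed (use assms in simp)

text \<open>The digit is frozen until its right neighbour first passes at or after \<open>t\<close>,
  which happens by time \<open>s\<close>.\<close>

lemma dig_incr:
  assumes "passes (dig x s (i + 1))"
  shows "t \<le> s \<Longrightarrow> \<exists>u>t. u \<le> Suc s \<and> dig x u i = incr (dig x t i)"
proof (induction t rule: inc_induct)
  case base
  show ?case using assms by (intro exI[of _ "Suc s"]) (simp add: dig_Suc)
next
  case (step t)
  show ?case
  proof (cases "passes (dig x t (i + 1))")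
    case True
    with step show ?thesis by (intro exI[of _ "Suc t"]) (simp add: dig_Suc)
  next
    case False
    then have "dig x (Suc t) i = dig x t i" by (simp add: dig_Suc)
    with step show ?thesis using Suc_lessD by fastforce
  qed
qed

text \<open>Induction on the distance to the blank: a neighbour that passes in every window of
  bounded length keeps incrementing the digit, which therefore reaches \<open>D2\<close>.
  \<open>M\<close> depends on \<open>n\<close> alone.\<close>

lemma passes_soon:
  "\<exists>M. \<forall>x t q. dig x t q = Blank \<longrightarrow> (\<exists>s\<ge>t. s \<le> t + M \<and> passes (dig x s (q - int n)))"
proof (induction n)
  case 0
  show ?case by (intro exI[of _ 0]) (auto simp: passes_def)
next
  case (Suc n)
  then obtain M where M: "\<And>x t q. dig x t q = Blank \<Longrightarrow>
    \<exists>s\<ge>t. s \<le> t + M \<and> passes (dig x s (q - int n))" by blast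
  have "\<exists>s\<ge>t. s \<le> t + 3 * Suc M \<and> passes (dig x s (q - int (Suc n)))"
    if q: "dig x t q = Blank" for x t q
  proof -
    let ?i = "q - int (Suc n)"
    have next_incr: "\<exists>u>v. u \<le> v + Suc M \<and> dig x u ?i = incr (dig x v ?i)" if v: "t \<le> v" for v
    proof -
      obtain s where "v \<le> s" "s \<le> v + M" "passes (dig x s (?i + 1))"
        using M[OF dig_Blank_mono[OF q v]] by (auto simp: algebra_simps)
      then show ?thesis using dig_incr[of s x ?i v] by force
    qed
    obtain u where u: "t < u" "u \<le> t + Suc M" "dig x u ?i = incr (dig x t ?i)"
      using next_incr[of t] by auto
    obtain v where v: "u < v" "v \<le> u + Suc M" "dig x v ?i = incr (dig x u ?i)"
      using next_incr[of u] u by auto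
    \<comment> \<open>Two increments suffice: three consecutive residues modulo 3 include 2.\<close>
    have "passes (dig x t ?i) \<or> passes (dig x u ?i) \<or> passes (dig x v ?i)"
      using u v by (cases "dig x t ?i") (auto simp: passes_def)
    moreover have "u \<le> t + 3 * Suc M" "v \<le> t + 3 * Suc M" "t \<le> u" "t \<le> v"
      using u v by auto
    ultimately show ?thesis by (meson le_add1 le_refl)
  qed
  then show ?case by blast
qed

section \<open>Emptying cells of arrows\<close>

text \<open>Passing at \<open>s0\<close> expels any arrow present, and none arrives from the right
  to replace it.\<close>

lemma no_arr_after_passing:
  assumes "\<And>s. t0 \<le> s \<Longrightarrow> s < t \<Longrightarrow> \<not> (arr x s (i + 1) \<and> passes (dig x s (i + 1)))"
    and "passes (dig x s0 i)" "t0 \<le> s0"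
  shows "Suc s0 \<le> s \<Longrightarrow> s \<le> t \<Longrightarrow> \<not> arr x s i"
proof (induction s rule: dec_induct)
  case base
  with assms show ?case by (auto simp: arr_Suc)
next
  case (step s)
  then show ?case using assms(1)[of s] assms(3) by (auto simp: arr_Suc)
qed

text \<open>\<open>K\<close> is uniform in the configuration, the position and the times, so that
  the length of the counter can be chosen after it.\<close>

definition clearing_time :: "nat \<Rightarrow> nat \<Rightarrow> bool" where
  "clearing_time n K \<longleftrightarrow> (\<forall>x t0 t q. dig x t0 q = Blank \<longrightarrow>
     (\<forall>s. t0 \<le> s \<longrightarrow> s < t \<longrightarrow> \<not> (arr x s (q + 1) \<and> passes (dig x s (q + 1)))) \<longrightarrow>
     (\<forall>s i. t0 + K \<le> s \<longrightarrow> s \<le> t \<longrightarrow> i \<le> n \<longrightarrow> \<not> arr x s (q - int i)))"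

lemma clearing_timeD:
  assumes "clearing_time n K" and "dig x t0 q = Blank"
    and "\<And>s. t0 \<le> s \<Longrightarrow> s < t \<Longrightarrow> \<not> (arr x s (q + 1) \<and> passes (dig x s (q + 1)))"
    and "t0 + K \<le> s" "s \<le> t" "i \<le> n"
  shows "\<not> arr x s (q - int i)"
  using assms unfolding clearing_time_def by blast

lemma ex_clearing_time: "\<exists>K. clearing_time n K"
proof (induction n)
  case 0
  show ?case
    unfolding clearing_time_def
  proof (intro exI[of _ 1] allI impI)
    fix x t0 t q s and i :: nat
    assume *: "dig x t0 q = Blank"
      "\<forall>s. t0 \<le> s \<longrightarrow> s < t \<longrightarrow> \<not> (arr x s (q + 1) \<and> passes (dig x s (q + 1)))"
      "t0 + 1 \<le> s" "s \<le> t" "i \<le> 0"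
    then have "\<not> arr x s q"
      by (intro no_arr_after_passing[of t0 t x q t0 s]) (auto simp: passes_def)
    with * show "\<not> arr x s (q - int i)" by simp
  qed
next
  case (Suc n)
  then obtain K where K: "clearing_time n K"
    by blast
  obtain M where M: "\<And>x t q. dig x t q = Blank \<Longrightarrow>
    \<exists>s\<ge>t. s \<le> t + M \<and> passes (dig x s (q - int (Suc n)))"
    using passes_soon by blast
  show ?case
    unfolding clearing_time_def
  \<comment> \<open>\<open>K\<close> steps empty the cells on the right, at most \<open>M\<close>
    more pass until the new cell passes, and one step lets its arrow leave.\<close>
  proof (intro exI[of _ "Suc (K + M)"] allI impI)
    fix x t0 t q s and i :: nat
    assume q: "dig x t0 q = Blank"
      and no: "\<forall>s. t0 \<le> s \<longrightarrow> s < t \<longrightarrow> \<not> (arr x s (q + 1) \<and> passes (dig x s (q + 1)))"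
      and s: "t0 + Suc (K + M) \<le> s" "s \<le> t" and i: "i \<le> Suc n"
    show "\<not> arr x s (q - int i)"
    proof (cases "i \<le> n")
      case True
      then show ?thesis using clearing_timeD[OF K q, of t s i] no s by simp
    next
      case False
      with i have i: "i = Suc n" by simp
      obtain s0 where s0: "t0 + K \<le> s0" "s0 \<le> t0 + K + M" "passes (dig x s0 (q - int i))"
        using M[OF dig_Blank_mono[OF q, of "t0 + K"]] i by auto
      have "\<not> arr x u (q - int i + 1)" if "t0 + K \<le> u" "u < t" for u
        using clearing_timeD[OF K q, of t u n] no that i by simp
      then show ?thesis
        using no_arr_after_passing[of "t0 + K" t x "q - int i" s0 s] s0 s by simp
    qed
  qed
qed

section \<open>The slow counter\<close>

text \<open>The digit at distance \<open>n\<close> to the left of a blank, at time \<open>t\<close>, when all these digits start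
  at \<open>0\<close>. It equals \<open>2\<close> precisely when the ternary digits of \<open>t\<close> at the positions of the binary
  ones of \<open>n\<close> are all \<open>2\<close>.\<close>

fun counter :: "nat \<Rightarrow> nat \<Rightarrow> sym1" where
  "counter n t =
     (if n = 0 then Blank
      else if even n then counter (n div 2) (t div 3)
      else if passes (counter (n div 2) (t div 3))
        then (if t mod 3 = 0 then D0 else if t mod 3 = 1 then D1 else D2)
      else D0)"

declare counter.simps [simp del]

lemma counter_0 [simp]: "counter 0 t = Blank"
  by (simp add: counter.simps)

lemma counter_double: "n > 0 \<Longrightarrow> counter (2 * n) t = counter n (t div 3)"
  by (subst counter.simps) simp

lemma counter_Suc_double:
  "counter (Suc (2 * n)) t =
     (if passes (counter n (t div 3))
      then (if t mod 3 = 0 then D0 else if t mod 3 = 1 then D1 else D2) else D0)"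
  by (subst counter.simps) simp

lemma counter_start: "n > 0 \<Longrightarrow> counter n 0 = D0"
proof (induction n rule: less_induct)
  case (less n)
  show ?case
    by (subst counter.simps) (use less in \<open>auto intro!: less.IH elim: evenE\<close>)
qed

text \<open>The closed form obeys the digit rule. For even \<open>n\<close> the digit at
  \<open>Suc n\<close> follows \<open>t mod 3\<close>; for odd \<open>n\<close> it runs at one third
  of the speed, and its neighbour passes only when \<open>t div 3\<close> is about to advance, which
  is where the induction hypothesis enters.\<close>

lemma counter_step:
  "counter (Suc n) (Suc t) =
     (if passes (counter n t) then incr (counter (Suc n) t) else counter (Suc n) t)"
proof (induction n arbitrary: t rule: less_induct)
  case (less n)
  have t: "t mod 3 = 0 \<and> Suc t mod 3 = 1 \<and> Suc t div 3 = t div 3 \<or>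
    t mod 3 = 1 \<and> Suc t mod 3 = 2 \<and> Suc t div 3 = t div 3 \<or>
    t mod 3 = 2 \<and> Suc t mod 3 = 0 \<and> Suc t div 3 = Suc (t div 3)"
    by presburger
  show ?case
  proof (cases "even n")
    case True
    then obtain m where m: "n = 2 * m" by (auto elim: evenE)
    have "passes (counter n t) \<longleftrightarrow> passes (counter m (t div 3))"
      by (cases "m = 0") (simp_all add: m counter_double)
    with t show ?thesis by (auto simp: m counter_Suc_double)
  next
    case False
    then obtain m where m: "n = Suc (2 * m)" by (auto elim: oddE)
    have S: "counter (Suc n) u = counter (Suc m) (u div 3)" for u
      using counter_double[of "Suc m" u] by (simp add: m)
    have "passes (counter n t) \<longleftrightarrow> passes (counter m (t div 3)) \<and> t mod 3 = 2"
      using t by (auto simp: m counter_Suc_double passes_def)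
    with t less.IH[of m "t div 3"] show ?thesis
      unfolding S by (auto simp: m)
  qed
qed

text \<open>All \<open>j\<close> binary digits of \<open>2 ^ j - 1\<close> are ones, so the last
  \<open>j\<close> ternary digits of \<open>t\<close> are all 2.\<close>

lemma passes_counter_dvd: "passes (counter (2 ^ j - 1) t) \<Longrightarrow> 3 ^ j dvd Suc t"
proof (induction j arbitrary: t)
  case (Suc j)
  have "(2::nat) ^ j > 0" by simp
  then have "2 ^ Suc j - 1 = Suc (2 * (2 ^ j - 1 :: nat))"
    unfolding power_Suc by linarith
  then have "passes (counter (2 ^ j - 1) (t div 3))" "t mod 3 = 2"
    using Suc.prems by (auto simp: counter_Suc_double passes_def split: if_splits)
  then have "3 ^ j dvd Suc (t div 3)" "Suc t = 3 * Suc (t div 3)"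
    using Suc.IH by auto presburger
  then show ?case by (metis mult_dvd_mono dvd_refl power_Suc)
qed simp

lemma dig_eq_counter:
  assumes "\<And>i. i \<le> k \<Longrightarrow> dig x 0 (r - int i) = counter i 0"
  shows "i \<le> k \<Longrightarrow> dig x t (r - int i) = counter i t"
proof (induction t arbitrary: i)
  case (Suc t)
  show ?case
  proof (cases i)
    case 0
    have "dig x 0 r = Blank" using assms[of 0] by simp
    with 0 show ?thesis using dig_Blank_mono[of 0 x r "Suc t"] by simp
  next
    case (Suc n)
    have "r - int i + 1 = r - int n" by (simp add: Suc)
    then have "dig x t (r - int i + 1) = counter n t" "dig x t (r - int i) = counter i t"
      using Suc.IH[of n] Suc.IH[of i] Suc.prems Suc by auto
    then show ?thesis by (simp add: dig_Suc Suc counter_step)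
  qed
qed (use assms in simp)

section \<open>Mean equicontinuity\<close>

lemma diam_mean_point_nearby:
  assumes "\<epsilon> > 0"
  shows "\<exists>y \<delta>. dist x y < (1/2) ^ m0 \<and> \<delta> > 0 \<and>
    limsup (\<lambda>n. ereal (1 / real (n + 1) * (\<Sum>i=0..n. diameter ((T ^^ i) ` ball y \<delta>)))) < ereal \<epsilon>"
proof -
  obtain m1 where m1: "(1/2) ^ m1 < \<epsilon> / 2"
    using real_arch_pow_inv[of "\<epsilon> / 2" "1/2"] assms by auto
  define m where "m = max m0 m1"
  have "(1/2::real) ^ m \<le> (1/2) ^ m1" by (rule power_decreasing) (auto simp: m_def)
  with m1 have m: "(1/2) ^ m < \<epsilon> / 2" by linarith
  define q where "q = int m + 1"
  \<comment> \<open>Seen from \<open>q\<close>, the window from \<open>-m\<close> to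
    \<open>m\<close> occupies the distances 1 to \<open>2 * m + 1\<close>.\<close>
  obtain K where K: "clearing_time (2 * m + 1) K"
    using ex_clearing_time by blast
  obtain j where j: "2 * real K / (\<epsilon> / 2) < 3 ^ j"
    using real_arch_pow[of 3 "2 * real K / (\<epsilon> / 2)"] by auto
  define k where "k = (2 ^ j - 1 :: nat)"
  \<comment> \<open>This puts \<open>q + 1\<close>, the gate through which arrows enter, at distance
    \<open>k\<close> from the blank at \<open>r\<close>.\<close>
  define r where "r = q + 1 + int k"
  define y where "y = Config (\<lambda>i. if i \<le> int m then cell x i
     else (if i = q \<or> i = r then Blank else D0, NoArrow))"
  \<comment> \<open>The ball fixes all cells up to \<open>r\<close>, hence both blanks and the whole
    counter.\<close>
  define \<delta> where "\<delta> = (1/2::real) ^ nat r"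
  have ball: "cell z i = cell y i" if "z \<in> ball y \<delta>" "\<bar>i\<bar> \<le> r" for z i
    using that unfolding mem_ball \<delta>_def dist_config_less_iff
    by (simp add: r_def q_def)
  have diam: "diameter ((T ^^ t) ` ball y \<delta>) \<le> (1/2) ^ m" if t: "K \<le> t mod 3 ^ j" for t
  proof -
    \<comment> \<open>The last multiple of \<open>3 ^ j\<close> up to \<open>t\<close>. The gate can
      open only at times \<open>s\<close> with \<open>3 ^ j\<close> dividing \<open>Suc s\<close>,
      so it is shut from \<open>t0\<close> until \<open>t\<close>.\<close>
    define t0 where "t0 = t - t mod 3 ^ j"
    have no_arr: "\<not> arr z t i" if z: "z \<in> ball y \<delta>" and i: "\<bar>i\<bar> \<le> int m" for z i
    proof -
      have "cell z q = cell y q" by (rule ball[OF z]) (simp add: q_def r_def)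
      then have "dig z 0 q = Blank" by (simp add: y_def q_def funpow.simps)
      then have q: "dig z t0 q = Blank" by (rule dig_Blank_mono) simp
      have "dig z 0 (r - int i) = counter i 0" if "i \<le> k" for i
      proof -
        have "cell z (r - int i) = cell y (r - int i)"
          using that by (intro ball[OF z]) (simp add: r_def q_def)
        then show ?thesis using that
          by (cases "i = 0") (auto simp: y_def r_def q_def funpow.simps counter_start)
      qed
      from dig_eq_counter[of k z r k, OF this]
      have c: "dig z s (q + 1) = counter k s" for s by (simp add: r_def)
      have "\<not> passes (dig z s (q + 1))" if s: "t0 \<le> s" "s < t" for s
      proof
        assume "passes (dig z s (q + 1))"
        then have "3 ^ j dvd Suc s"
          unfolding c k_def by (rule passes_counter_dvd)
        moreover have "3 ^ j dvd t0" by (simp add: t0_def)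
        ultimately have "3 ^ j dvd Suc s - t0" by (rule dvd_diff_nat)
        moreover have "0 < Suc s - t0" "Suc s - t0 < 3 ^ j"
          using s mod_less_divisor[of "3 ^ j" t] by (auto simp: t0_def simp del: mod_less_divisor)
        ultimately show False using dvd_imp_le not_le by blast
      qed
      moreover have "t0 + K \<le> t" using t mod_less_eq_dividend[of t "3 ^ j"] unfolding t0_def by linarith
      moreover have "nat (q - i) \<le> 2 * m + 1" using i by (simp add: q_def)
      ultimately have "\<not> arr z t (q - int (nat (q - i)))"
        by (intro clearing_timeD[OF K q, of t]) auto
      moreover have "q - int (nat (q - i)) = i" using i by (simp add: q_def)
      ultimately show ?thesis by simp
    qed
    have dig: "dig z t i = dig y t i" if z: "z \<in> ball y \<delta>" and i: "\<bar>i\<bar> \<le> int m" for z i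
    proof (rule dig_eq_left_of_Blank[of "- int m" q])
      show "dig z 0 i = dig y 0 i" if "- int m \<le> i" "i \<le> q" for i
        using ball[OF z, of i] that by (simp add: funpow.simps q_def r_def)
      have "cell z q = cell y q" by (rule ball[OF z]) (simp add: q_def r_def)
      then show "dig z 0 q = Blank" by (simp add: y_def q_def funpow.simps)
    qed (use i in \<open>auto simp: q_def\<close>)
    have "dist ((T ^^ t) z) ((T ^^ t) z') \<le> (1/2) ^ m"
      if z: "z \<in> ball y \<delta>" "z' \<in> ball y \<delta>" for z z'
    proof -
      have "cell ((T ^^ t) z) i = cell ((T ^^ t) z') i" if i: "\<bar>i\<bar> \<le> int m" for i
        using no_arr[OF z(1) i] no_arr[OF z(2) i] dig[OF z(1) i] dig[OF z(2) i]
        by (intro prod_eqI; cases "snd (cell ((T ^^ t) z) i)"; cases "snd (cell ((T ^^ t) z') i)") auto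
      then show ?thesis by (simp add: dist_config_less_iff order.strict_implies_order)
    qed
    then show ?thesis by (intro diameter_leI) auto
  qed
  have "limsup (\<lambda>n. ereal (1 / real (n + 1) * (\<Sum>i=0..n. diameter ((T ^^ i) ` ball y \<delta>))))
      \<le> ereal ((1/2) ^ m + 2 * K / (3 ^ j :: nat))"
    using diam by (intro limsup_average_le) (auto intro!: diameter_leI[of 1] dist_config_le_1)
  also have "\<dots> < ereal \<epsilon>"
  proof -
    have "2 * real K / 3 ^ j < \<epsilon> / 2" using j assms by (simp add: field_simps)
    with m show ?thesis by simp
  qed
  finally have "limsup (\<lambda>n. ereal (1 / real (n + 1) *
    (\<Sum>i=0..n. diameter ((T ^^ i) ` ball y \<delta>)))) < ereal \<epsilon>" .
  moreover have "dist x y < (1/2) ^ m0"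
    unfolding dist_config_less_iff by (auto simp: y_def m_def)
  moreover have "\<delta> > 0" by (simp add: \<delta>_def)
  ultimately show ?thesis by blast
qed

section \<open>Failure of equicontinuity\<close>

text \<open>The arrow waits until its cell first passes, at time \<open>s\<close> at the latest, and
  then steps left.\<close>

lemma arr_moves_left:
  assumes "arr x t i" "passes (dig x s i)" "t \<le> s"
  shows "\<exists>u>t. arr x u (i - 1)"
  using assms(3,1)
proof (induction t rule: inc_induct)
  case base
  with assms(2) show ?case by (intro exI[of _ "Suc s"]) (simp add: arr_Suc)
next
  case (step t)
  show ?case
  proof (cases "passes (dig x t i)")
    case True
    with step.prems show ?thesis by (intro exI[of _ "Suc t"]) (simp add: arr_Suc)
  next
    case False
    with step.prems have "arr x (Suc t) i" by (simp add: arr_Suc)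
    with step.IH show ?thesis using Suc_lessD by blast
  qed
qed

lemma not_equicontinuity_point: "\<not> equicontinuity_point T x"
proof
  assume "equicontinuity_point T x"
  \<comment> \<open>The bound 1 is chosen because distance below 1 means agreement at the
    origin.\<close>
  then obtain \<delta> where "\<delta> > 0" and \<delta>: "\<And>t. diameter ((T ^^ t) ` ball x \<delta>) < 1"
    unfolding equicontinuity_point_def by (meson zero_less_one)
  then obtain R where R: "(1/2) ^ R < \<delta>"
    using real_arch_pow_inv[of \<delta> "1/2"] by auto
  define w where "w a = Config (\<lambda>i. if i \<le> int R then cell x i else (Blank, a))" for a
  have wb: "w a \<in> ball x \<delta>" for a
  proof -
    have "dist x (w a) < (1/2) ^ R"
      unfolding dist_config_less_iff by (auto simp: w_def)
    with R show ?thesis by simp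
  qed
  define q where "q = int R + 1"
  have Blank: "dig (w a) t i = Blank" if "q \<le> i" for a t i
    by (rule dig_Blank_mono[of 0]) (use that in \<open>auto simp: w_def q_def funpow.simps\<close>)
  have no: "\<not> arr (w NoArrow) t i" if "q \<le> i" for t i
    using that
  proof (induction t arbitrary: i)
    case (Suc t)
    then show ?case by (simp add: arr_Suc)
  qed (auto simp: w_def q_def funpow.simps)
  have arr: "arr (w Arrow) t i" if "q \<le> i" for t i
    using that
  proof (induction t arbitrary: i)
    case (Suc t)
    then show ?case using Blank[of "i + 1" t Arrow] by (simp add: arr_Suc passes_def)
  qed (auto simp: w_def q_def funpow.simps)
  \<comment> \<open>Recurrence is carried leftwards cell by cell: a late arrow at one cell yields a
    later one at the next.\<close>
  have reach: "\<exists>t\<ge>t0. arr (w Arrow) t (q - int n)" for t0 n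
  proof (induction n arbitrary: t0)
    case 0
    show ?case using arr[of q t0] by auto
  next
    case (Suc n)
    then obtain t where t: "t0 \<le> t" "arr (w Arrow) t (q - int n)" by blast
    obtain s where "t \<le> s" "passes (dig (w Arrow) s (q - int n))"
      using passes_soon[of n] Blank[of q] by blast
    from arr_moves_left[OF t(2) this(2,1)] obtain u where "u > t" "arr (w Arrow) u (q - int n - 1)"
      by blast
    with t show ?case by (intro exI[of _ u]) (simp add: algebra_simps)
  qed
  \<comment> \<open>The origin lies at distance \<open>nat q\<close> to the left of the blank at
    \<open>q\<close>.\<close>
  obtain K where "clearing_time (nat q) K"
    using ex_clearing_time by blast
  then have "\<not> arr (w NoArrow) s (q - int (nat q))" if "K \<le> s" for s
    by (rule clearing_timeD[of _ _ 0 _ _ s]) (use that Blank[of q 0 NoArrow] no in auto)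
  then have K: "\<not> arr (w NoArrow) s 0" if "K \<le> s" for s
    using that by (simp add: q_def)
  obtain t where t: "K \<le> t" "arr (w Arrow) t 0"
    using reach[of K "nat q"] by (auto simp: q_def)
  have "\<not> dist ((T ^^ t) (w Arrow)) ((T ^^ t) (w NoArrow)) < 1"
    using K[OF t(1)] t(2) unfolding dist_config_less_1_iff by metis
  moreover have "dist ((T ^^ t) (w Arrow)) ((T ^^ t) (w NoArrow)) \<le> diameter ((T ^^ t) ` ball x \<delta>)"
    by (intro diameter_bounded_bound bounded_config imageI wb)
  ultimately show False using \<delta>[of t] by linarith
qed

theorem theorem3p22:
  shows "almost_diam_mean_equicontinuous T \<and> \<not> almost_equicontinuous T"
proof
  show "almost_diam_mean_equicontinuous T"
    using diam_mean_point_nearby by (rule almost_diam_mean_equicontinuous_configI)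
  show "\<not> almost_equicontinuous T"
    using residual_config_nonempty[of "{x. equicontinuity_point T x}"]
    by (auto simp: almost_equicontinuous_def not_equicontinuity_point)
qed

end
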